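(* Let $A=\{a_1,\dots,a_n\}$ and $B=\{b_1,\dots,b_m\}$ be finite sets, let $R\subseteq A\times B$ and $w:R\to\mathbb{R}^{+}$, and let $\varphi:\mathbb{R}^{+}\to\mathbb{R}^{+}$ be any function. Let $\mathbf{W}=[w_{ij}]$ be the $m\times n$ weight matrix with $w_{ij}=w(a_j,b_i)$ if $(a_j,b_i)\in R$ and $w_{ij}=0$ otherwise, and let $\mathbf{W}'$ be the $n\times m$ reverse weight matrix whose $(i,j)$ entry is $\varphi(w(a_i,b_j))$. Suppose $\mathbf{W}$ is a positive matrix (all entries positive; in particular $R=A\times B$). Then there exists a unique pair $(\mathbf{a},\mathbf{b})$ with $\mathbf{a}\in(\mathbb{R}^{+})^{n}$, $\mathbf{b}\in(\mathbb{R}^{+})^{m}$ such that for some $\lambda>0$ and $\mu>0$ $$\mathbf{b}=\lambda\mathbf{W}\mathbf{a},\qquad \mathbf{a}=\mu\mathbf{W}'\mathbf{b},\qquad \|\mathbf{a}\|=\|\mathbf{b}\|=1.$$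
   Context: $\mathbb{R}^{+}$ denotes the positive reals, so $(\mathbb{R}^{+})^{k}$ is the set of vectors with all entries positive. $\|\cdot\|$ is the Euclidean norm. A pair $(\mathbf{a},\mathbf{b})$ as in the claim is called the normed eigenvector bicentrality sequence (NEBS) associated with the positive weight relation $(R,w)$ and its reverse relation $(R^{-1},w')$, where $w'(b_i,a_j)=\varphi(w(a_j,b_i))$. *)

theory Defs
  imports "HOL-Analysis.Analysis"
begin

text \<open>The enumerations \<open>a\<close> and \<open>b\<close> list the underlying sets; the relation goes from the
  \<open>a\<close>-side (columns) to the \<open>b\<close>-side (rows). Values of \<open>w\<close> outside \<open>R\<close> are never used.\<close>

definition weight_matrix ::
  "('a \<times> 'b) set \<Rightarrow> ('a \<times> 'b \<Rightarrow> real) \<Rightarrow> ('n::finite \<Rightarrow> 'a) \<Rightarrow> ('m::finite \<Rightarrow> 'b) \<Rightarrow> real^'n^'m" where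
  "weight_matrix R w a b = (\<chi> i j. if (a j, b i) \<in> R then w (a j, b i) else 0)"

definition reverse_weight :: "(real \<Rightarrow> real) \<Rightarrow> ('a \<times> 'b \<Rightarrow> real) \<Rightarrow> ('b \<times> 'a \<Rightarrow> real)" where
  "reverse_weight \<phi> w = (\<lambda>(y, x). \<phi> (w (x, y)))"

definition reverse_weight_matrix ::
  "(real \<Rightarrow> real) \<Rightarrow> ('a \<times> 'b) set \<Rightarrow> ('a \<times> 'b \<Rightarrow> real) \<Rightarrow> ('n::finite \<Rightarrow> 'a) \<Rightarrow> ('m::finite \<Rightarrow> 'b)
    \<Rightarrow> real^'m^'n" where
  "reverse_weight_matrix \<phi> R w a b = weight_matrix (R\<inverse>) (reverse_weight \<phi> w) b a"

definition positive_matrix :: "real^'n^'m \<Rightarrow> bool" where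
  "positive_matrix M \<longleftrightarrow> (\<forall>i j. M $ i $ j > 0)"

definition positive_vector :: "real^'n \<Rightarrow> bool" where
  "positive_vector v \<longleftrightarrow> (\<forall>i. v $ i > 0)"

end

theory Submission imports Defs begin

text \<open>The claim is Perron's theorem for the positive square matrix \<open>W' ** W\<close>: the
  first component of a solution is a positive unit eigenvector of it, and determines the second.
  Existence comes from Brouwer's fixed point theorem on the standard simplex. For uniqueness,
  subtract from one positive eigenvector the largest multiple of the other that leaves a nonnegative
  vector; if the difference is nonzero, the matrix makes it positive, which forces
  a strict inequality between the eigenvalues, and exchanging the roles gives a contradiction.\<close>

text \<open>A single positive coordinate of \<open>x\<close> already makes every row sum positive.
  This passage from nonnegative and nonzero to strictly positive drives both existence and
  uniqueness.\<close>

lemma positive_matrix_vector_mult: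
  fixes M :: "real^'n^'m"
  assumes "positive_matrix M" and "\<And>i. x $ i \<ge> 0" and "x \<noteq> 0"
  shows "positive_vector (M *v x)"
  unfolding positive_vector_def
proof
  fix i
  obtain k where "x $ k \<noteq> 0"
    using \<open>x \<noteq> 0\<close> by (auto simp: vec_eq_iff)
  then have "x $ k > 0"
    using assms(2)[of k] by linarith
  then have "0 < (\<Sum>j\<in>UNIV. M $ i $ j * x $ j)"
    using assms(1,2) by (intro sum_pos2[of _ k]) (auto simp: positive_matrix_def less_imp_le)
  then show "(M *v x) $ i > 0"
    by (simp add: matrix_vector_mult_def)
qed

lemma positive_vector_nonneg: "positive_vector x \<Longrightarrow> x $ i \<ge> 0"
  by (simp add: positive_vector_def less_imp_le)

lemma positive_vector_nonzero: "positive_vector x \<Longrightarrow> x \<noteq> 0"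
  by (auto simp: positive_vector_def)

lemma positive_vector_scaleR: "c > 0 \<Longrightarrow> positive_vector x \<Longrightarrow> positive_vector (c *\<^sub>R x)"
  by (simp add: positive_vector_def)

lemma positive_matrix_mult:
  fixes M :: "real^'n^'m" and N :: "real^'k^'n"
  assumes "positive_matrix M" and "positive_matrix N"
  shows "positive_matrix (M ** N)"
  using assms by (auto simp: positive_matrix_def matrix_matrix_mult_def intro!: sum_pos)

text \<open>Both scalars must be the inverse of \<open>norm v\<close>. This turns proportionality of
  solutions into equality.\<close>

lemma scaleR_unit_eq:
  fixes v :: "'v::real_normed_vector"
  assumes "c > 0" and "d > 0" and "norm (c *\<^sub>R v) = 1" and "norm (d *\<^sub>R v) = 1"
  shows "c *\<^sub>R v = d *\<^sub>R v"
proof -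
  have "c * norm v = d * norm v" "v \<noteq> 0"
    using assms by auto
  then show ?thesis
    by simp
qed

lemma exists_positive_eigenvector:
  fixes M :: "real^'n^'n"
  assumes M: "positive_matrix M"
  obtains x r where "positive_vector x" "r > 0" "M *v x = r *\<^sub>R x"
proof -
  define S :: "(real^'n) set" where "S = {x. (\<forall>i. x $ i \<ge> 0) \<and> (\<Sum>i\<in>UNIV. x $ i) = 1}"
  \<comment> \<open>Dividing \<open>M *v x\<close> by its coordinate sum \<open>\<sigma> x\<close>
    brings it back to the simplex; at a fixed point \<open>\<sigma> x\<close> is the
    eigenvalue.\<close>
  define \<sigma> :: "real^'n \<Rightarrow> real" where "\<sigma> x = (\<Sum>i\<in>UNIV. (M *v x) $ i)" for x
  have pos: "positive_vector (M *v x)" if "x \<in> S" for x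
    using that by (intro positive_matrix_vector_mult[OF M]) (auto simp: S_def)
  have \<sigma>_pos: "\<sigma> x > 0" if "x \<in> S" for x
    using pos[OF that] unfolding \<sigma>_def by (intro sum_pos) (auto simp: positive_vector_def)
  have "closed S"
    unfolding S_def
    by (intro closed_Collect_conj closed_Collect_all closed_Collect_le closed_Collect_eq
        continuous_intros)
  moreover have "bounded S"
  proof (rule boundedI[of _ 1])
    fix x assume x: "x \<in> S"
    have "norm x \<le> (\<Sum>i\<in>UNIV. \<bar>x $ i\<bar>)"
      by (rule norm_le_l1_cart)
    also have "\<dots> = 1"
      using x by (simp add: S_def)
    finally show "norm x \<le> 1" .
  qed
  ultimately have "compact S"
    by (simp add: compact_eq_bounded_closed)
  moreover have "convex S"
    by (auto simp: S_def convex_def sum.distrib simp flip: sum_distrib_left)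
  moreover have "axis (undefined::'n) 1 \<in> S"
    by (auto simp: S_def axis_def)
  then have "S \<noteq> {}"
    by blast
  moreover have "continuous_on S (\<lambda>x. inverse (\<sigma> x) *\<^sub>R (M *v x))"
    using \<sigma>_pos unfolding \<sigma>_def
    by (intro continuous_intros matrix_vector_mult_linear_continuous_on) (auto simp: less_le)
  moreover have "(\<lambda>x. inverse (\<sigma> x) *\<^sub>R (M *v x)) \<in> S \<rightarrow> S"
  proof
    fix x assume x: "x \<in> S"
    have "(\<Sum>i\<in>UNIV. inverse (\<sigma> x) * (M *v x) $ i) = inverse (\<sigma> x) * \<sigma> x"
      by (simp add: \<sigma>_def sum_distrib_left)
    then show "inverse (\<sigma> x) *\<^sub>R (M *v x) \<in> S"
      using \<sigma>_pos[OF x] positive_vector_nonneg[OF pos[OF x]] by (simp add: S_def)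
  qed
  ultimately obtain x where x: "x \<in> S" and fix_x: "inverse (\<sigma> x) *\<^sub>R (M *v x) = x"
    by (rule brouwer)
  show thesis
  proof
    \<comment> \<open>Membership in \<open>S\<close> gives only nonnegative coordinates; strict
      positivity comes from \<open>x\<close> being a positive multiple of
      \<open>M *v x\<close>.\<close>
    show "positive_vector x"
      using positive_vector_scaleR[OF _ pos[OF x], of "inverse (\<sigma> x)"] \<sigma>_pos[OF x] fix_x by simp
    show "\<sigma> x > 0"
      by (rule \<sigma>_pos[OF x])
    have "\<sigma> x *\<^sub>R x = \<sigma> x *\<^sub>R (inverse (\<sigma> x) *\<^sub>R (M *v x))"
      by (simp only: fix_x)
    then show "M *v x = \<sigma> x *\<^sub>R x"
      using \<sigma>_pos[OF x] by simp
  qed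
qed

lemma positive_eigenvectors_compare:
  fixes M :: "real^'n^'n"
  assumes M: "positive_matrix M"
    and x: "positive_vector x" "M *v x = r *\<^sub>R x"
    and z: "positive_vector z" "M *v z = s *\<^sub>R z"
  shows "(\<exists>t>0. x = t *\<^sub>R z) \<or> s < r"
proof -
  \<comment> \<open>The least ratio is the largest \<open>t\<close> for which
    \<open>x - t *\<^sub>R z\<close> is nonnegative; where it is attained, at \<open>k\<close>, the
    difference vanishes.\<close>
  define t where "t = Min (range (\<lambda>i. x $ i / z $ i))"
  have "t \<in> range (\<lambda>i. x $ i / z $ i)"
    unfolding t_def by (intro Min_in) auto
  then obtain k where k: "t = x $ k / z $ k"
    by auto
  have pos: "x $ i > 0" "z $ i > 0" for i
    using x z by (auto simp: positive_vector_def)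
  have t: "t > 0" and xk: "x $ k = t * z $ k"
    using k pos[of k] by auto
  have le: "t * z $ i \<le> x $ i" for i
  proof -
    have "t \<le> x $ i / z $ i"
      unfolding t_def by (intro Min_le) auto
    then show ?thesis
      using pos[of i] by (simp add: pos_le_divide_eq)
  qed
  show ?thesis
  proof (cases "x = t *\<^sub>R z")
    case False
    then have "positive_vector (M *v (x - t *\<^sub>R z))"
      using le by (intro positive_matrix_vector_mult[OF M]) auto
    also have "M *v (x - t *\<^sub>R z) = r *\<^sub>R x - t *\<^sub>R (s *\<^sub>R z)"
      by (simp add: matrix_vector_mult_diff_distrib matrix_vector_mult_scaleR x z)
    \<comment> \<open>At coordinate \<open>k\<close> the two terms share the factor
      \<open>x $ k = t * z $ k\<close>, so the sign is that of \<open>r - s\<close>.\<close>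
    finally have "0 < (r *\<^sub>R x - t *\<^sub>R (s *\<^sub>R z)) $ k"
      by (simp add: positive_vector_def)
    also have "\<dots> = (r - s) * x $ k"
      by (simp add: xk algebra_simps)
    finally show ?thesis
      using pos[of k] by (simp add: zero_less_mult_iff)
  qed (use t in blast)
qed

text \<open>If neither vector were a positive multiple of the other, comparing in both directions
  would give \<open>s < r\<close> and \<open>r < s\<close>.\<close>

lemma positive_eigenvectors_proportional:
  fixes M :: "real^'n^'n"
  assumes "positive_matrix M"
    and "positive_vector x" "M *v x = r *\<^sub>R x"
    and "positive_vector z" "M *v z = s *\<^sub>R z"
  obtains t where "t > 0" "x = t *\<^sub>R z"
proof -
  consider t where "t > 0" "x = t *\<^sub>R z" | t where "t > 0" "z = t *\<^sub>R x"
    using positive_eigenvectors_compare[OF assms]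
      positive_eigenvectors_compare[OF assms(1,4,5,2,3)] by force
  then show thesis
  proof cases
    case (2 t)
    then show thesis
      using that[of "inverse t"] by simp
  qed (rule that)
qed

text \<open>The pure matrix form of the claim, for any two positive matrices of matching dimensions;
  the relation and \<open>\<phi>\<close> serve to supply such a pair.\<close>

lemma positive_bicentrality_exists_unique:
  fixes W :: "real^'n^'m" and W' :: "real^'m^'n"
  assumes W: "positive_matrix W" and W': "positive_matrix W'"
  shows "\<exists>!(x :: real^'n, y :: real^'m).
    positive_vector x \<and> positive_vector y \<and>
    (\<exists>l > 0. \<exists>\<mu> > 0. y = l *\<^sub>R (W *v x) \<and> x = \<mu> *\<^sub>R (W' *v y) \<and> norm x = 1 \<and> norm y = 1)"
    (is "\<exists>!(x, y). ?P x y")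
proof -
  have M: "positive_matrix (W' ** W)"
    by (rule positive_matrix_mult[OF W' W])
  have "\<exists>x y. ?P x y"
  proof -
    obtain u r where u: "positive_vector u" and r: "r > 0" "(W' ** W) *v u = r *\<^sub>R u"
      by (rule exists_positive_eigenvector[OF M])
    define x where "x = inverse (norm u) *\<^sub>R u"
    \<comment> \<open>The condition \<open>norm y = 1\<close> forces this scalar.\<close>
    define l where "l = inverse (norm (W *v x))"
    have "norm u > 0"
      using positive_vector_nonzero[OF u] by simp
    then have x: "positive_vector x" "norm x = 1" and Mx: "(W' ** W) *v x = r *\<^sub>R x"
      using u r by (auto simp: x_def positive_vector_scaleR matrix_vector_mult_scaleR)
    have Wx: "positive_vector (W *v x)"
      using x by (intro positive_matrix_vector_mult[OF W])
        (auto simp: positive_vector_nonneg positive_vector_nonzero)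
    then have l: "l > 0" "norm (l *\<^sub>R (W *v x)) = 1"
      using positive_vector_nonzero[OF Wx] by (auto simp: l_def)
    have "W' *v (l *\<^sub>R (W *v x)) = (l * r) *\<^sub>R x"
      by (simp add: matrix_vector_mult_scaleR matrix_vector_mul_assoc Mx)
    \<comment> \<open>The witness for \<open>\<mu>\<close> is \<open>inverse (l * r)\<close>, which
      cancels the factor acquired by going from \<open>x\<close> to \<open>y\<close> and
      back.\<close>
    then have "x = inverse (l * r) *\<^sub>R (W' *v (l *\<^sub>R (W *v x)))" "inverse (l * r) > 0"
      using l r by (auto simp: field_simps)
    then have "?P x (l *\<^sub>R (W *v x))"
      using x l positive_vector_scaleR[OF l(1) Wx] by blast
    then show ?thesis
      by blast
  qed
  moreover have "x = x' \<and> y = y'" if P: "?P x y" and P': "?P x' y'" for x y x' y'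
  proof -
    \<comment> \<open>Eliminating \<open>y\<close> from the two equations leaves an eigenvector
      equation with eigenvalue \<open>inverse (\<mu> * l)\<close>.\<close>
    have eigen: "\<exists>s. (W' ** W) *v x = s *\<^sub>R x" if "?P x y" for x y
    proof -
      from that obtain l \<mu> where l: "l > 0" "\<mu> > 0"
        and y: "y = l *\<^sub>R (W *v x)" and x: "x = \<mu> *\<^sub>R (W' *v y)"
        by blast
      have "x = (\<mu> * l) *\<^sub>R ((W' ** W) *v x)"
        using x unfolding y by (simp add: matrix_vector_mult_scaleR matrix_vector_mul_assoc)
      then have "inverse (\<mu> * l) *\<^sub>R x = inverse (\<mu> * l) *\<^sub>R ((\<mu> * l) *\<^sub>R ((W' ** W) *v x))"
        by (rule arg_cong)
      also have "\<dots> = (W' ** W) *v x"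
        using l by (simp add: field_simps)
      finally show ?thesis
        by metis
    qed
    obtain s s' where "(W' ** W) *v x = s *\<^sub>R x" "(W' ** W) *v x' = s' *\<^sub>R x'"
      using eigen[OF P] eigen[OF P'] by blast
    then obtain t where "t > 0" "x = t *\<^sub>R x'"
      using positive_eigenvectors_proportional[OF M] P P' by metis
    moreover have "norm x = 1" "norm x' = 1"
      using P P' by blast+
    ultimately have x: "x = x'"
      using scaleR_unit_eq[of t 1 x'] by simp
    \<comment> \<open>With the first components equal, \<open>y\<close> and \<open>y'\<close> are
      positive unit multiples of the same vector \<open>W *v x\<close>.\<close>
    obtain l l' where "l > 0" "l' > 0" "y = l *\<^sub>R (W *v x)" "y' = l' *\<^sub>R (W *v x)"
      and "norm y = 1" "norm y' = 1"
      using P P' x by blast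
    then show ?thesis
      using x scaleR_unit_eq[of l l' "W *v x"] by simp
  qed
  ultimately have "\<exists>!p. case p of (x, y) \<Rightarrow> ?P x y"
    unfolding Ex1_def split_paired_Ex split_paired_All prod.case prod.inject by blast
  then show ?thesis .
qed

theorem theorem3p1:
  fixes A :: "'a set" and B :: "'b set"
    and a :: "'n::finite \<Rightarrow> 'a" and b :: "'m::finite \<Rightarrow> 'b"
    and R :: "('a \<times> 'b) set" and w :: "'a \<times> 'b \<Rightarrow> real" and \<phi> :: "real \<Rightarrow> real"
    and W :: "real^'n^'m" and W' :: "real^'m^'n"
  assumes "bij_betw a UNIV A" and "bij_betw b UNIV B"
    and "R \<subseteq> A \<times> B"
    and "\<And>p. p \<in> R \<Longrightarrow> w p > 0"
    and "\<And>t. t > 0 \<Longrightarrow> \<phi> t > 0"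
  defines "W \<equiv> weight_matrix R w a b"
    and "W' \<equiv> reverse_weight_matrix \<phi> R w a b"
  assumes "positive_matrix W"
  shows "\<exists>!(x :: real^'n, y :: real^'m).
    positive_vector x \<and> positive_vector y \<and>
    (\<exists>l > 0. \<exists>\<mu> > 0. y = l *\<^sub>R (W *v x) \<and> x = \<mu> *\<^sub>R (W' *v y) \<and> norm x = 1 \<and> norm y = 1)"
proof (rule positive_bicentrality_exists_unique)
  show "positive_matrix W"
    by fact
  \<comment> \<open>Entries outside \<open>R\<close> are zero, so positivity of \<open>W\<close>
    puts every pair in \<open>R\<close>; each entry of \<open>W'\<close> is then
    \<open>\<phi>\<close> of a positive weight.\<close>
  have "(a j, b i) \<in> R" for i j
  proof (rule ccontr)
    assume "(a j, b i) \<notin> R"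
    then have "W $ i $ j = 0"
      by (simp add: W_def weight_matrix_def)
    then show False
      using \<open>positive_matrix W\<close> by (simp add: positive_matrix_def less_le)
  qed
  then show "positive_matrix W'"
    using assms(4,5)
    by (simp add: W'_def positive_matrix_def reverse_weight_matrix_def weight_matrix_def
        reverse_weight_def)
qed

end
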